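(* Let $K_n$ be a complete graph. Then $\mathrm{mpd}(K_n)=\infty$.
   Context: $K_n$ denotes the complete graph with $n$ vertices. $d(u,v)$ denotes the shortest-path distance. Let $G$ be a graph and let $\Pi=\{S_1,\dots,S_t\}$ be a partition of $V(G)$. For $v\in V(G)$ put $d(v,S_i)=\min\{d(v,x):x\in S_i\}$. The multiset partition representation of $v$ with respect to $\Pi$ is the multiset $r_{mp}(v\mid\Pi)=\{d(v,S_1),\dots,d(v,S_t)\}$ (order ignored, multiplicities kept). $\Pi$ is a resolving multiset partition if $r_{mp}(u\mid\Pi)\ne r_{mp}(v\mid\Pi)$ for all distinct $u,v\in V(G)$. The multiset partition dimension $\mathrm{mpd}(G)$ is the minimum number $t$ of parts of a resolving multiset partition of $G$, and $\mathrm{mpd}(G)=\infty$ if no resolving multiset partition exists.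
   Formalization: The formal statement assumes n ≥ 2; for n = 1 the claim fails, since the one-part partition of K_1 is vacuously resolving and so mpd(K_1) = 1. *)

theory Defs
  imports
    "Graph_Theory.Shortest_Path"
    "Graph_Theory.Kuratowski"
    "HOL-Library.Disjoint_Sets"
    "HOL-Library.Multiset"
    "HOL-Library.Extended_Nat"
begin

text \<open>
  The locale \<^locale>\<open>graph\<close> describes finite simple graphs, given as symmetric digraphs:
  each undirected edge is a pair of opposite arcs.
\<close>

context graph
begin

text \<open>With unit arc costs the cost of a walk is its length.\<close>

definition dist_verts :: "'a \<Rightarrow> 'a \<Rightarrow> ereal" where
  "dist_verts u v = \<mu> (\<lambda>_. 1) u v"

text \<open>The minimum is only meaningful for nonempty finite \<open>S\<close>, such as a part of a
  partition of \<^term>\<open>verts G\<close>.\<close>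

definition dist_set :: "'a \<Rightarrow> 'a set \<Rightarrow> ereal" where
  "dist_set v S = Min (dist_verts v ` S)"

definition multiset_repr :: "'a \<Rightarrow> 'a set set \<Rightarrow> ereal multiset" where
  "multiset_repr v P = {# dist_set v S. S \<in># mset_set P #}"

definition resolving_multiset_partition :: "'a set set \<Rightarrow> bool" where
  "resolving_multiset_partition P \<longleftrightarrow>
     partition_on (verts G) P \<and>
     (\<forall>u\<in>verts G. \<forall>v\<in>verts G. u \<noteq> v \<longrightarrow> multiset_repr u P \<noteq> multiset_repr v P)"

text \<open>In \<^typ>\<open>enat\<close> a nonempty set contains its infimum, and the infimum of the empty set
  is \<open>\<infinity>\<close>.\<close>

definition mpd :: enat where
  "mpd = Inf {enat (card P) | P. resolving_multiset_partition P}"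

end

end

theory Submission
  imports Defs
begin

text \<open>
  In a complete graph every vertex has distance 0 to its own part and distance 1 to each of the
  other parts, so all vertices have the same representation with respect to any given partition.
\<close>

context graph
begin

lemma awalk_cost_const_one: "awalk_cost (\<lambda>_. 1) p = real (length p)"
  by (induction p) auto

lemma dist_verts_self:
  assumes "u \<in> verts G"
  shows "dist_verts u u = 0"
proof (rule antisym)
  have "awalk u [] u"
    using assms by (simp add: awalk_Nil_iff)
  from min_cost_le_walk_cost[OF this, of "\<lambda>_. 1"] show "dist_verts u u \<le> 0"
    by (simp add: dist_verts_def zero_ereal_def)
  \<comment> \<open>\<open>\<mu>\<close> is an infimum over all walks, so a lower bound has to hold
    for every walk; with unit costs each cost is a length and hence nonnegative.\<close>
  show "0 \<le> dist_verts u u"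
    unfolding dist_verts_def \<mu>_def
    by (rule INF_greatest) (simp add: awalk_cost_const_one)
qed

text \<open>The arc itself is a walk of cost 1. Nothing is cheaper, since only the empty walk has
  length 0 and it cannot join distinct vertices.\<close>

lemma dist_verts_adjacent:
  assumes "u \<rightarrow>\<^bsub>G\<^esub> v"
  shows "dist_verts u v = 1"
proof (rule antisym)
  obtain e where e: "e \<in> arcs G" "tail G e = u" "head G e = v"
    using assms by (auto simp: arcs_ends_def arc_to_ends_def)
  then have "awalk u [e] v"
    using arc_implies_awalk by blast
  from min_cost_le_walk_cost[OF this, of "\<lambda>_. 1"] show "dist_verts u v \<le> 1"
    by (simp add: dist_verts_def one_ereal_def)
  \<comment> \<open>The graph has no loops, so the ends of an arc differ.\<close>
  have "u \<noteq> v"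
    using e no_loops by auto
  then have "p \<noteq> []" if "awalk u p v" for p
    using that by (auto simp: awalk_Nil_iff)
  then have "1 \<le> length p" if "awalk u p v" for p
    using that by (simp add: Suc_le_eq)
  then show "1 \<le> dist_verts u v"
    unfolding dist_verts_def \<mu>_def
    by (intro INF_greatest) (simp add: awalk_cost_const_one)
qed

text \<open>Distances between vertices are only 0 or 1, and 0 occurs exactly at \<open>v\<close>, so
  the minimum just records membership of \<open>v\<close> in \<open>S\<close>.\<close>

lemma dist_set_complete:
  assumes complete: "\<And>x y. x \<in> verts G \<Longrightarrow> y \<in> verts G \<Longrightarrow> x \<noteq> y \<Longrightarrow> x \<rightarrow>\<^bsub>G\<^esub> y"
    and "v \<in> verts G" "S \<subseteq> verts G" "S \<noteq> {}"
  shows "dist_set v S = (if v \<in> S then 0 else 1)"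
proof -
  have dist: "dist_verts v x = (if x = v then 0 else 1)" if "x \<in> S" for x
    using that assms dist_verts_self dist_verts_adjacent by auto
  have "finite S"
    using assms finite_verts finite_subset by blast
  show ?thesis
  proof (cases "v \<in> S")
    case True
    then have "Min (dist_verts v ` S) = 0"
      using \<open>finite S\<close> dist by (intro Min_eqI) (auto simp: image_iff split: if_splits)
    with True show ?thesis
      by (simp add: dist_set_def)
  next
    case False
    \<comment> \<open>Nonemptiness of \<open>S\<close> makes the image a singleton rather than
      empty, where \<open>Min\<close> would be unspecified.\<close>
    then have "dist_verts v ` S = {1}"
      using dist \<open>S \<noteq> {}\<close> by (auto simp: image_iff)
    with False show ?thesis
      by (simp add: dist_set_def)
  qed
qed

text \<open>Exactly one part contains \<open>v\<close> and contributes the 0; the other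
  \<open>card P - 1\<close> parts contribute 1 each. What matters later is that \<open>v\<close>
  does not occur on the right-hand side.\<close>

lemma multiset_repr_complete:
  assumes complete: "\<And>x y. x \<in> verts G \<Longrightarrow> y \<in> verts G \<Longrightarrow> x \<noteq> y \<Longrightarrow> x \<rightarrow>\<^bsub>G\<^esub> y"
    and "partition_on (verts G) P" "v \<in> verts G"
  shows "multiset_repr v P = add_mset 0 (replicate_mset (card P - 1) 1)"
proof -
  have "finite P"
    using assms finite_elements finite_verts by blast
  obtain A where A: "A \<in> P" "v \<in> A"
    using assms partition_onD1 by blast
  have parts: "S \<subseteq> verts G" "S \<noteq> {}" if "S \<in> P" for S
    using that assms(2) by (auto simp: partition_on_def)
  have other: "v \<notin> S" if "S \<in> P - {A}" for S
    using that A disjointD[OF partition_onD2[OF assms(2)], of A S] by blast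
  have "mset_set P = add_mset A (mset_set (P - {A}))"
    using A \<open>finite P\<close> by (simp add: mset_set.remove)
  moreover have "dist_set v A = 0"
    using A assms(3) parts dist_set_complete[OF complete] by simp
  moreover have "image_mset (dist_set v) (mset_set (P - {A})) = image_mset (\<lambda>_. 1) (mset_set (P - {A}))"
    using other parts assms(3) \<open>finite P\<close> dist_set_complete[OF complete]
    by (intro image_mset_cong) auto
  ultimately show ?thesis
    using A \<open>finite P\<close> by (simp add: multiset_repr_def image_mset_const_eq)
qed

end

theorem theorem4p1:
  fixes G :: "('a, 'b) pre_digraph" and n :: nat
  assumes "2 \<le> n"
    and "K\<^bsub>n\<^esub> G"
  shows "graph.mpd G = \<infinity>"
proof -
  interpret graph G
    using assms by (simp add: complete_digraph_def)
  have complete: "x \<rightarrow>\<^bsub>G\<^esub> y" if "x \<in> verts G" "y \<in> verts G" "x \<noteq> y" for x y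
    using that assms(2) by (simp add: complete_digraph_def)
  have "2 \<le> card (verts G)"
    using assms by (simp add: complete_digraph_def)
  \<comment> \<open>This is where \<open>2 \<le> n\<close> enters: on a single vertex the one-part
    partition is vacuously resolving.\<close>
  then obtain u v where uv: "u \<in> verts G" "v \<in> verts G" "u \<noteq> v"
    by (auto simp: numeral_2_eq_2 card_le_Suc_iff)
  have "\<not> resolving_multiset_partition P" for P
    using uv multiset_repr_complete[OF complete] unfolding resolving_multiset_partition_def by metis
  \<comment> \<open>The infimum in \<open>mpd\<close> is over the empty set, which gives
    \<open>\<infinity>\<close> in \<open>enat\<close>.\<close>
  then show ?thesis
    by (simp add: mpd_def Inf_enat_def)
qed

end
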